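(* The eigenvalue problem $$u_n''(x)+\Big[\frac{A}{k_0}x^q+(1-q)x^{-1}\Big]u_n'(x)-\frac{A(q+1)}{k_0}\,n\,x^{q-1}u_n(x)=0,$$ $$x^{1-q}u_n'(x)\big|_{x=0}=0,\qquad q>-1,$$ is solved by the monomials $$u_n(x)=\hat M^n1,\qquad \hat M=A\,x^q\hat D_x^{-1}+k_0 .$$ The eigenfunctions $u_n(x)$ are expressed in terms of generalized Laguerre polynomials by $$u_n(x)=\frac{\Gamma\!\big(\frac{1}{1+q}\big)\,n!}{\Gamma\!\big(n+\frac{1}{1+q}\big)}\,k_0^n\,L_n^{(\alpha)}(z),\qquad \alpha=-\frac{q}{q+1},\qquad z=-\frac{A}{k_0(q+1)}x^{q+1}.$$ Their normalization is given by $$\int_0^\infty\Big(\frac{A}{q+1}\Big)^{\frac{q}{q+1}}\frac{1}{A}\,e^{\frac{A\,x^{q+1}}{k_0(q+1)}}\,u_n(x)\,u_m(x)\,dx=\frac{\big(\Gamma(\frac{1}{1+q})\big)^2\,n!}{\Gamma\!\big(n+\frac{1}{1+q}\big)}\Big(\frac{A}{q+1}\Big)^{\frac{2q}{q+1}}\frac{1}{A^2}\,(-k_0)^{\frac{1}{q+1}}\,\delta_{n,m}.$$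
   Context: $n,m\ge0$ are integers; $A$, $k_0$, $q$ are constants. $\hat D_x^{-1}u(x)=\int_0^xu(\xi)\,d\xi$, primes denote derivatives with respect to $x$, and $\hat M^n1$ is the operator $\hat M$ applied $n$ times to the constant function $1$. $L_n^{(\alpha)}(z)=\sum_{j=0}^n\frac{(-1)^j}{j!}\binom{n+\alpha}{n-j}z^j$ are the generalized Laguerre polynomials, and $\delta_{n,m}$ is the Kronecker delta.
   Formalization: The printed normalization lacks a factor k_0^{2n} on the right (false for q=0, A=1, k_0=-k, n=m=1: k^3 versus k); the corrected formula is proved for real constants with A/k_0<0, where the integral converges, with powers of negative constants read as principal values. *)

theory Defs
  imports "HOL-Analysis.Analysis"
begin

definition Dx_inv :: "(real \<Rightarrow> real) \<Rightarrow> real \<Rightarrow> real" where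
  "Dx_inv u x = (LBINT \<xi>=ereal 0..ereal x. u \<xi>)"

definition M_op :: "real \<Rightarrow> real \<Rightarrow> real \<Rightarrow> (real \<Rightarrow> real) \<Rightarrow> real \<Rightarrow> real" where
  "M_op A k0 q u x = A * x powr q * Dx_inv u x + k0 * u x"

definition monomial :: "real \<Rightarrow> real \<Rightarrow> real \<Rightarrow> nat \<Rightarrow> real \<Rightarrow> real" where
  "monomial A k0 q n = (M_op A k0 q ^^ n) (\<lambda>_. 1)"

definition gen_laguerre :: "nat \<Rightarrow> real \<Rightarrow> real \<Rightarrow> real" where
  "gen_laguerre n \<alpha> z =
     (\<Sum>j\<le>n. (-1) ^ j / fact j * ((real n + \<alpha>) gchoose (n - j)) * z ^ j)"

(* The coefficients are singular at 0 for general q, so the equation is posed on the open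
   half-line and the condition at x = 0 is a one-sided limit.  As usual, an eigenfunction
   is required to be nonzero. *)
definition eigenfunction :: "real \<Rightarrow> real \<Rightarrow> real \<Rightarrow> nat \<Rightarrow> (real \<Rightarrow> real) \<Rightarrow> bool" where
  "eigenfunction A k0 q n u \<longleftrightarrow>
     (\<exists>u' u''.
        (\<forall>x>0. (u has_real_derivative u' x) (at x) \<and>
               (u' has_real_derivative u'' x) (at x) \<and>
               u'' x + (A / k0 * x powr q + (1 - q) * x powr (-1)) * u' x
                 - A * (q + 1) / k0 * real n * x powr (q - 1) * u x = 0) \<and>
        ((\<lambda>x. x powr (1 - q) * u' x) \<longlongrightarrow> 0) (at_right 0)) \<and>
     (\<exists>x>0. u x \<noteq> 0)"

(* Powers of the real constants A / (q + 1) and - k0, which may both be negative, are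
   principal complex powers; they are the ordinary real powers when A > 0 and k0 < 0. *)
definition cpow :: "real \<Rightarrow> real \<Rightarrow> complex" where
  "cpow a s = complex_of_real a powr complex_of_real s"

definition norm_integrand ::
  "real \<Rightarrow> real \<Rightarrow> real \<Rightarrow> nat \<Rightarrow> nat \<Rightarrow> real \<Rightarrow> complex" where
  "norm_integrand A k0 q n m x =
     cpow (A / (q + 1)) (q / (q + 1)) * of_real (1 / A)
       * of_real (exp (A * x powr (q + 1) / (k0 * (q + 1)))
                  * monomial A k0 q n x * monomial A k0 q m x)"

end

theory Submission
  imports Defs
begin

text \<open>
  Put s = 1/(q+1), b = A/(q+1) and X = x^(q+1). On powers of X the operator M acts by
  X^j \<mapsto> (b/(j+s)) X^(j+1) + k0 X^j, so that
  u_n = sum_j (n choose j) k0^(n-j) b^j / (s)_j X^j with the Pochhammer symbol (s)_j.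
  In the variable X the eigenvalue equation becomes Kummer's equation, which is the two-term
  recurrence for these coefficients. For the normalization put c = -b/k0 > 0: up to a common
  constant the i-th moment of exp(-c X) dx is (s)_i / c^i, so the integral of u_n X^i is a multiple
  of sum_j (-1)^j (n choose j) (s+j)_i, the n-th finite difference of a monic polynomial of degree i;
  it vanishes for i < n and equals (-1)^n n! for i = n.
\<close>

section \<open>Finite differences of Pochhammer symbols\<close>

text \<open>Pascal's rule turns the left side into an alternating sum of differences (s+j)_(k+1) -
  (s+j+1)_(k+1). The two symbols share the factor (s+j+1)_k, and the remaining linear factors differ
  by -(k+1).\<close>

lemma alternating_sum_pochhammer_Suc:
  fixes s :: real
  shows "(\<Sum>j\<le>Suc n. (-1)^j * real (Suc n choose j) * pochhammer (s + real j) (Suc k)) =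
         - real (Suc k) * (\<Sum>j\<le>n. (-1)^j * real (n choose j) * pochhammer (s + 1 + real j) k)"
proof -
  let ?f = "\<lambda>j. pochhammer (s + real j) (Suc k)"
  have a: "(\<Sum>j\<le>Suc n. (-1)^j * real (Suc n choose j) * ?f j) =
      ?f 0 + (\<Sum>j\<le>n. (-1)^Suc j * real (n choose Suc j) * ?f (Suc j))
      - (\<Sum>j\<le>n. (-1)^j * real (n choose j) * ?f (Suc j))"
    by (subst sum.atMost_Suc_shift) (simp add: algebra_simps sum.distrib sum_negf sum_subtractf)
  \<comment> \<open>The index is shifted back; afterwards the top term drops out because
    \<open>n choose Suc n\<close> is 0.\<close>
  have b: "?f 0 + (\<Sum>j\<le>n. (-1)^Suc j * real (n choose Suc j) * ?f (Suc j)) =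
      (\<Sum>j\<le>Suc n. (-1)^j * real (n choose j) * ?f j)"
    by (subst sum.atMost_Suc_shift) simp
  have c: "\<dots> = (\<Sum>j\<le>n. (-1)^j * real (n choose j) * ?f j)"
    by simp
  have d: "?f j - ?f (Suc j) = - real (Suc k) * pochhammer (s + 1 + real j) k" for j
    using pochhammer_rec[of "s + real j" k] pochhammer_Suc[of "s + 1 + real j" k]
    by (simp add: algebra_simps)
  show ?thesis
    unfolding a b c sum_subtractf[symmetric] sum_distrib_left
    unfolding right_diff_distrib[symmetric] d by (simp only: mult_ac)
qed

text \<open>Each differencing lowers n and k together and moves s to s + 1, so the induction keeps s
  and k free. At k = 0 the alternating sum of a full binomial row remains, which vanishes for
  positive n.\<close>

lemma alternating_sum_pochhammer:
  fixes s :: real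
  assumes "k \<le> n"
  shows "(\<Sum>j\<le>n. (-1)^j * real (n choose j) * pochhammer (s + real j) k) =
         (if k = n then (-1)^n * fact n else 0)"
  using assms
proof (induction n arbitrary: s k)
  case (Suc n)
  show ?case
  proof (cases k)
    case 0
    have "(\<Sum>j\<le>Suc n. (-1)^j * real (Suc n choose j)) = 0"
      using choose_alternating_sum[of "Suc n", where 'a = real] by simp
    then show ?thesis using 0 by simp
  next
    case (Suc k')
    then have "k' \<le> n" using Suc.prems by simp
    then show ?thesis
      unfolding Suc alternating_sum_pochhammer_Suc by (subst Suc.IH) (simp_all add: algebra_simps)
  qed
qed simp

lemma Gamma_add_of_nat_pochhammer:
  fixes s :: real
  assumes "s > 0"
  shows "Gamma (real n + s) = Gamma s * pochhammer s n"
proof -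
  have "s \<notin> \<int>\<^sub>\<le>\<^sub>0" using assms by (auto elim!: nonpos_Ints_cases)
  then show ?thesis
    using pochhammer_Gamma[of s n] Gamma_real_pos[OF assms] by (simp add: add.commute)
qed

section \<open>The coefficients of u_n in the variable X and Kummer's equation\<close>

text \<open>Intended for b = A/(q+1), k = k0, s = 1/(q+1). The truncated exponent
  \<open>n - j\<close> is harmless, as the binomial vanishes for j > n.\<close>

definition monomial_coeff :: "real \<Rightarrow> real \<Rightarrow> real \<Rightarrow> nat \<Rightarrow> nat \<Rightarrow> real" where
  "monomial_coeff b k s n j = real (n choose j) * k ^ (n - j) * b ^ j / pochhammer s j"

text \<open>A formal polynomial, so that differential equations can be checked on coefficients with
  \<open>pderiv\<close>.\<close>

definition monomial_poly :: "real \<Rightarrow> real \<Rightarrow> real \<Rightarrow> nat \<Rightarrow> real poly" where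
  "monomial_poly b k s n = (\<Sum>j\<le>n. monom (monomial_coeff b k s n j) j)"

lemma monomial_coeff_eq_0: "n < j \<Longrightarrow> monomial_coeff b k s n j = 0"
  by (simp add: monomial_coeff_def)

lemma coeff_monomial_poly: "coeff (monomial_poly b k s n) j = monomial_coeff b k s n j"
  by (simp add: monomial_poly_def coeff_sum monomial_coeff_eq_0 if_distrib cong: if_cong)

lemma poly_monomial_poly: "poly (monomial_poly b k s n) x = (\<Sum>j\<le>n. monomial_coeff b k s n j * x ^ j)"
  by (simp add: monomial_poly_def poly_sum poly_monom)

text \<open>One application of M, read on coefficients. It is Pascal's rule together with (s)_(j+1)
  = (s)_j (s+j).\<close>

lemma monomial_coeff_Suc_Suc:
  assumes "s > 0"
  shows "monomial_coeff b k s (Suc n) (Suc j) = b / (s + real j) * monomial_coeff b k s n j + k * monomial_coeff b k s n (Suc j)"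
proof -
  define t where "t = s + real j"
  have p: "pochhammer s j > 0" "t > 0"
    using assms by (auto simp: t_def intro: pochhammer_pos)
  show ?thesis
    unfolding t_def[symmetric]
  proof (cases "j < n")
    case True
    then have "k ^ (n - j) = k * k ^ (n - Suc j)"
      by (metis Suc_diff_Suc power_Suc)
    then show "monomial_coeff b k s (Suc n) (Suc j) = b / t * monomial_coeff b k s n j + k * monomial_coeff b k s n (Suc j)"
      using p by (simp add: monomial_coeff_def pochhammer_Suc field_simps flip: t_def)
  next
    case False
    then show "monomial_coeff b k s (Suc n) (Suc j) = b / t * monomial_coeff b k s n j + k * monomial_coeff b k s n (Suc j)"
      using p by (simp add: monomial_coeff_def pochhammer_Suc field_simps flip: t_def)
  qed
qed

text \<open>Follows from (j+1) (n choose j+1) = (n-j) (n choose j). This is the term ratio of the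
  confluent hypergeometric series 1F1(-n; s; -(b/k) X), of which the polynomial is k^n times the
  sum.\<close>

lemma monomial_coeff_ratio:
  assumes "s > 0" "k \<noteq> 0"
  shows "real (Suc j) * (s + real j) * monomial_coeff b k s n (Suc j) = b / k * (real n - real j) * monomial_coeff b k s n j"
proof (cases "j < n")
  case True
  define t where "t = s + real j"
  have p: "pochhammer s j > 0" "t > 0"
    using assms by (auto simp: t_def intro: pochhammer_pos)
  have "real (Suc j) * real (n choose Suc j) = (real n - real j) * real (n choose j)"
  proof -
    have "Suc j * (n choose Suc j) = (n - j) * (n choose j)"
      unfolding binomial_absorb_comp binomial_absorption ..
    from arg_cong[OF this, of real] show ?thesis
      using True by (simp only: of_nat_mult of_nat_diff less_imp_le)
  qed
  moreover have "k ^ (n - j) = k * k ^ (n - Suc j)"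
    using True by (metis Suc_diff_Suc power_Suc)
  moreover have "real (Suc j) * t * monomial_coeff b k s n (Suc j) =
      (real (Suc j) * real (n choose Suc j)) * k ^ (n - Suc j) * b ^ Suc j / pochhammer s j"
    using p by (simp add: monomial_coeff_def pochhammer_Suc flip: t_def)
  ultimately show ?thesis
    using p assms unfolding t_def[symmetric] by (simp add: monomial_coeff_def)
next
  case False
  then show ?thesis
    by (cases "j = n") (simp_all add: monomial_coeff_eq_0)
qed

lemma monomial_poly_ode:
  assumes "s > 0" "k \<noteq> 0"
  shows "x * poly (pderiv (pderiv (monomial_poly b k s n))) x + (s + b / k * x) * poly (pderiv (monomial_poly b k s n)) x
    = b / k * real n * poly (monomial_poly b k s n) x"
proof -
  let ?p = "monomial_poly b k s n"
  \<comment> \<open>\<open>pCons 0\<close> is multiplication by the variable; the coefficient of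
    degree j of this identity is the ratio above.\<close>
  have "pCons 0 (pderiv (pderiv ?p)) + smult s (pderiv ?p) + smult (b / k) (pCons 0 (pderiv ?p))
      = smult (b / k * real n) ?p"
  proof (rule poly_eqI)
    fix j
    show "coeff (pCons 0 (pderiv (pderiv ?p)) + smult s (pderiv ?p) + smult (b / k) (pCons 0 (pderiv ?p))) j
      = coeff (smult (b / k * real n) ?p) j"
      using monomial_coeff_ratio[OF assms, of j b n]
      by (cases j) (simp_all add: coeff_pderiv coeff_monomial_poly algebra_simps)
  qed
  from arg_cong[OF this, of "\<lambda>p. poly p x"] show ?thesis
    by (simp add: algebra_simps)
qed

section \<open>The operator M on powers of X\<close>

lemma Dx_inv_powr_sum:
  assumes q: "q > -1" and x: "x \<ge> 0"
  shows "Dx_inv (\<lambda>x. \<Sum>j\<le>n. c j * (x powr (q + 1)) ^ j) x =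
         (\<Sum>j\<le>n. c j / (real j * (q + 1) + 1) * (x * (x powr (q + 1)) ^ j))"
    (is "Dx_inv ?f x = ?F x")
proof -
  have cont: "continuous_on {0..x} (\<lambda>x. x powr (q + 1))"
    using q by (intro continuous_on_powr') (auto intro: continuous_intros)
  \<comment> \<open>For q < 0 the power x^(q+1) has no derivative at 0, so the product rule is used
    in the interior only; continuity suffices at the endpoints.\<close>
  have "(?f has_integral (?F x - ?F 0)) {0..x}"
  proof (rule fundamental_theorem_of_calculus_interior[OF x])
    show "continuous_on {0..x} ?F"
      by (intro continuous_intros cont)
    fix y assume "y \<in> {0<..<x}"
    then have y: "y > 0" by simp
    have "((\<lambda>x. x * (x powr (q + 1)) ^ j) has_real_derivative (real j * (q + 1) + 1) * (y powr (q + 1)) ^ j) (at y)" for j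
    proof -
      have "((\<lambda>x. (x powr (q + 1)) ^ j) has_real_derivative
          real j * ((q + 1) * y powr q * (y powr (q + 1)) ^ (j - Suc 0))) (at y)"
        using DERIV_power[OF has_real_derivative_powr[OF y, of "q + 1"], of j] by simp
      from DERIV_mult[OF DERIV_ident this]
      have "((\<lambda>x. x * (x powr (q + 1)) ^ j) has_real_derivative
          1 * (y powr (q + 1)) ^ j + real j * ((q + 1) * y powr q * (y powr (q + 1)) ^ (j - Suc 0)) * y) (at y)" .
      then show ?thesis
      proof (rule DERIV_cong)
        have "real j * ((q + 1) * y powr q * (y powr (q + 1)) ^ (j - Suc 0)) * y = real j * (q + 1) * (y powr (q + 1)) ^ j"
          using y by (cases j) (simp_all add: powr_add)
        then show "1 * (y powr (q + 1)) ^ j + real j * ((q + 1) * y powr q * (y powr (q + 1)) ^ (j - Suc 0)) * y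
            = (real j * (q + 1) + 1) * (y powr (q + 1)) ^ j"
          by (simp only: distrib_right[of _ 1] mult_1_left add.commute[of "(y powr (q + 1)) ^ j"])
      qed
    qed
    note D = this
    have "(?F has_real_derivative (\<Sum>j\<le>n. c j / (real j * (q + 1) + 1) * ((real j * (q + 1) + 1) * (y powr (q + 1)) ^ j))) (at y)"
      by (intro DERIV_sum DERIV_cmult D)
    also have "(\<Sum>j\<le>n. c j / (real j * (q + 1) + 1) * ((real j * (q + 1) + 1) * (y powr (q + 1)) ^ j)) = ?f y"
    proof (rule sum.cong)
      fix j
      have "real j * (q + 1) + 1 > 0" using q by (simp add: add_nonneg_pos)
      then show "c j / (real j * (q + 1) + 1) * ((real j * (q + 1) + 1) * (y powr (q + 1)) ^ j) = c j * (y powr (q + 1)) ^ j"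
        by simp
    qed simp
    finally show "(?F has_vector_derivative ?f y) (at y)"
      by (simp add: has_real_derivative_iff_has_vector_derivative)
  qed
  then have I: "integral {0..x} ?f = ?F x" by (simp add: integral_unique)
  \<comment> \<open>\<open>Dx_inv\<close> is a Lebesgue integral, the fundamental theorem yields a
    gauge integral; integrability of the continuous integrand identifies them.\<close>
  have "set_integrable lborel {0..x} ?f"
    by (intro borel_integrable_atLeastAtMost' continuous_intros cont)
  then show ?thesis
    using interval_integral_eq_integral[OF x, of ?f] I by (simp add: Dx_inv_def)
qed

text \<open>Induction on n, with x free because the integral involves all points between 0 and x.
  Integration sends X^j to x X^j / (j(q+1)+1), and the factor A x^q makes this b/(s+j)
  X^(j+1).\<close>

lemma monomial_eq_monomial_poly:
  assumes q: "q > -1" and "x \<ge> 0"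
  shows "monomial A k q n x = poly (monomial_poly (A / (q + 1)) k (1 / (q + 1)) n) (x powr (q + 1))"
  using assms(2)
proof (induction n arbitrary: x)
  case 0
  then show ?case by (simp add: monomial_def poly_monomial_poly monomial_coeff_def)
next
  case (Suc n)
  let ?s = "1 / (q + 1)" and ?b = "A / (q + 1)"
  let ?c = "monomial_coeff ?b k ?s"
  let ?X = "x powr (q + 1)"
  \<comment> \<open>Valid at x = 0 too, where both sides are 0.\<close>
  have xq: "x powr q * x = ?X"
    using Suc.prems by (cases "x = 0") (simp_all add: powr_add)
  have "Dx_inv (monomial A k q n) x = Dx_inv (\<lambda>x. \<Sum>j\<le>n. ?c n j * (x powr (q + 1)) ^ j) x"
    unfolding Dx_inv_def
    by (rule interval_integral_cong) (use Suc in \<open>auto simp: poly_monomial_poly einterval_def\<close>)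
  also have "\<dots> = (\<Sum>j\<le>n. ?c n j / (real j * (q + 1) + 1) * (x * ?X ^ j))"
    by (rule Dx_inv_powr_sum[OF q Suc.prems])
  finally have D: "Dx_inv (monomial A k q n) x = \<dots>" .
  have "monomial A k q (Suc n) x = A * x powr q * Dx_inv (monomial A k q n) x + k * monomial A k q n x"
    by (simp add: monomial_def M_op_def)
  also have "A * x powr q * Dx_inv (monomial A k q n) x = (\<Sum>j\<le>n. ?b / (?s + real j) * ?c n j * ?X ^ Suc j)"
    unfolding D sum_distrib_left
  proof (rule sum.cong)
    fix j
    have r: "real j * (q + 1) + 1 > 0" "q + 1 > 0" using q by (simp_all add: add_nonneg_pos)
    have "?s + real j = (real j * (q + 1) + 1) / (q + 1)" using r by (simp add: field_simps)
    then have B: "?b / (?s + real j) = A / (real j * (q + 1) + 1)" using r by simp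
    show "A * x powr q * (?c n j / (real j * (q + 1) + 1) * (x * ?X ^ j)) = ?b / (?s + real j) * ?c n j * ?X ^ Suc j"
      unfolding B power_Suc xq[symmetric] by (simp only: mult_ac times_divide_eq_left times_divide_eq_right)
  qed simp
  also have "k * monomial A k q n x = k * ?c n 0 + (\<Sum>j\<le>n. k * ?c n (Suc j) * ?X ^ Suc j)"
  proof -
    \<comment> \<open>A vanishing top term is added, so that splitting off j = 0 leaves the same
      index range as in the integrated sum.\<close>
    have "(\<Sum>j\<le>n. ?c n j * ?X ^ j) = (\<Sum>j\<le>Suc n. ?c n j * ?X ^ j)"
      by (simp add: monomial_coeff_eq_0)
    also have "\<dots> = ?c n 0 + (\<Sum>j\<le>n. ?c n (Suc j) * ?X ^ Suc j)"
      by (subst sum.atMost_Suc_shift) simp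
    finally show ?thesis
      by (simp add: Suc poly_monomial_poly distrib_left sum_distrib_left mult.assoc)
  qed
  also have "(\<Sum>j\<le>n. ?b / (?s + real j) * ?c n j * ?X ^ Suc j) + (k * ?c n 0 + (\<Sum>j\<le>n. k * ?c n (Suc j) * ?X ^ Suc j))
     = ?c (Suc n) 0 + (\<Sum>j\<le>n. ?c (Suc n) (Suc j) * ?X ^ Suc j)"
    using q by (subst monomial_coeff_Suc_Suc) (simp_all add: monomial_coeff_def[of _ _ _ _ 0] distrib_right sum.distrib)
  also have "\<dots> = poly (monomial_poly ?b k ?s (Suc n)) ?X"
    unfolding poly_monomial_poly by (subst sum.atMost_Suc_shift) simp
  finally show ?case .
qed

section \<open>The Laguerre form\<close>

text \<open>The terms agree one by one: for \<alpha> = s - 1 the binomial is (s)_n / ((s)_j (n-j)!),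
  the Gamma quotient cancels (s)_n, and the minus sign in the argument cancels (-1)^j.\<close>

lemma monomial_poly_eq_gen_laguerre:
  assumes s: "s > 0" and k: "k \<noteq> 0"
  shows "poly (monomial_poly b k s n) x =
    Gamma s * fact n / Gamma (real n + s) * k ^ n * gen_laguerre n (s - 1) (- (b / k) * x)"
  unfolding poly_monomial_poly gen_laguerre_def sum_distrib_left
proof (rule sum.cong)
  fix j assume "j \<in> {..n}"
  then have j: "j \<le> n" by simp
  have p: "pochhammer s n > 0" "pochhammer s j > 0"
    using s by (auto intro: pochhammer_pos)
  have G: "Gamma s * fact n / Gamma (real n + s) = fact n / pochhammer s n"
    unfolding Gamma_add_of_nat_pochhammer[OF s] using Gamma_real_pos[OF s] by simp
  have "(real n + (s - 1)) gchoose (n - j) = pochhammer (s + real j) (n - j) / fact (n - j)"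
    using j by (simp add: gbinomial_pochhammer' of_nat_diff algebra_simps)
  also have "\<dots> = pochhammer s n / pochhammer s j / fact (n - j)"
    using pochhammer_product[OF j, of s] p by simp
  finally have B: "(real n + (s - 1)) gchoose (n - j) = \<dots>" .
  have K: "k ^ n = k ^ (n - j) * k ^ j" using j by (simp flip: power_add)
  have M: "(- (b / k) * x) ^ j = (-1) ^ j * b ^ j / k ^ j * x ^ j"
    using power_minus[of "b / k * x" j] by (simp add: power_mult_distrib power_divide)
  have C: "real (n choose j) = fact n / (fact j * fact (n - j))"
    using binomial_fact[OF j] by simp
  show "monomial_coeff b k s n j * x ^ j = Gamma s * fact n / Gamma (real n + s) * k ^ n *
      ((- 1) ^ j / fact j * (real n + (s - 1) gchoose (n - j)) * (- (b / k) * x) ^ j)"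
    unfolding G B K M C monomial_coeff_def using p k by (simp add: field_simps)
qed simp

section \<open>The eigenvalue problem\<close>

lemma has_real_derivative_poly_powr:
  assumes "x > 0"
  shows "((\<lambda>x. poly p (x powr r)) has_real_derivative poly (pderiv p) (x powr r) * (r * x powr (r - 1))) (at x)"
  by (rule DERIV_chain2[OF poly_DERIV]) (use assms in \<open>auto intro!: derivative_eq_intros\<close>)

text \<open>By the chain rule the equation at x is (q+1)^2 x^(q-1) times Kummer's equation at X =
  x^(q+1).\<close>

lemma eigenfunction_monomial:
  assumes k: "k \<noteq> 0" and q: "q > -1"
  shows "eigenfunction A k q n (monomial A k q n)"
proof -
  define p where "p = monomial_poly (A / (q + 1)) k (1 / (q + 1)) n"
  define u' where "u' x = poly (pderiv p) (x powr (q + 1)) * ((q + 1) * x powr q)" for x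
  define u'' where "u'' x = poly (pderiv (pderiv p)) (x powr (q + 1)) * ((q + 1) * x powr q) * ((q + 1) * x powr q)
     + poly (pderiv p) (x powr (q + 1)) * ((q + 1) * (q * x powr (q - 1)))" for x
  have u: "monomial A k q n x = poly p (x powr (q + 1))" if "x \<ge> 0" for x
    unfolding p_def by (rule monomial_eq_monomial_poly[OF q that])
  have d1: "(monomial A k q n has_real_derivative u' x) (at x)" if "x > 0" for x
  proof (rule has_field_derivative_transform_within_open[where S = "{0<..}"])
    show "((\<lambda>x. poly p (x powr (q + 1))) has_real_derivative u' x) (at x)"
      using has_real_derivative_poly_powr[OF that, of p "q + 1"] by (simp add: u'_def)
  qed (use that u in auto)
  have d2: "(u' has_real_derivative u'' x) (at x)" if "x > 0" for x
  proof -
    have "((\<lambda>x. (q + 1) * x powr q) has_real_derivative (q + 1) * (q * x powr (q - 1))) (at x)"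
      by (intro DERIV_cmult has_real_derivative_powr that)
    from DERIV_mult[OF has_real_derivative_poly_powr[OF that, of "pderiv p" "q + 1"] this]
    show ?thesis unfolding u'_def u''_def by (simp add: mult_ac)
  qed
  have ode: "u'' x + (A / k * x powr q + (1 - q) * x powr (-1)) * u' x
      - A * (q + 1) / k * real n * x powr (q - 1) * monomial A k q n x = 0" if x: "x > 0" for x
  proof -
    let ?X = "x powr (q + 1)"
    \<comment> \<open>All real powers are expressed through y = x^(q-1) and x, which leaves a
      rational identity.\<close>
    define y where "y = x powr q / x"
    have e: "x powr q = y * x" "x powr (q - 1) = y" "?X = y * x * x" "x powr (-1) = 1 / x"
      using x by (simp_all add: y_def powr_add powr_diff powr_minus_divide)
    define f0 f1 f2 where "f0 = poly p ?X" and "f1 = poly (pderiv p) ?X" and "f2 = poly (pderiv (pderiv p)) ?X"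
    define s K where "s = 1 / (q + 1)" and "K = A / (q + 1) / k"
    have sK: "(q + 1) * s = 1" "(q + 1) * K = A / k" using q by (simp_all add: s_def K_def)
    have o: "?X * f2 + (s + K * ?X) * f1 = K * real n * f0"
      unfolding f0_def f1_def f2_def p_def s_def K_def using q k by (intro monomial_poly_ode) auto
    have "(q + 1) * ?X * f2 + ((q + 1) * s + (q + 1) * K * ?X) * f1 = (q + 1) * (?X * f2 + (s + K * ?X) * f1)"
      by (simp only: distrib_left distrib_right mult.assoc)
    also have "\<dots> = (q + 1) * K * real n * f0"
      unfolding o by (simp only: mult.assoc)
    finally have "(q + 1) * ?X * f2 + (1 + A / k * ?X) * f1 = A / k * real n * f0"
      unfolding sK .
    then have o': "(q + 1) * y * ((q + 1) * ?X * f2 + (1 + A / k * ?X) * f1) = (q + 1) * y * (A / k * real n * f0)"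
      by simp
    have "u'' x + (A / k * x powr q + (1 - q) * x powr (-1)) * u' x
      - A * (q + 1) / k * real n * x powr (q - 1) * monomial A k q n x
      = (q + 1) * y * ((q + 1) * ?X * f2 + (1 + A / k * ?X) * f1) - (q + 1) * y * (A / k * real n * f0)"
      unfolding u''_def u'_def u[OF less_imp_le[OF x]] f0_def[symmetric] f1_def[symmetric] f2_def[symmetric]
      unfolding e using x k by (simp add: field_simps)
    then show ?thesis unfolding o' by simp
  qed
  have X0: "((\<lambda>x. x powr (q + 1)) \<longlongrightarrow> 0) (at_right (0::real))"
  proof -
    have "((\<lambda>x. x powr (q + 1)) \<longlongrightarrow> 0 powr (q + 1)) (at_right (0::real))"
      by (rule tendsto_powr') (use q in \<open>auto intro: tendsto_intros simp: eventually_at_filter\<close>)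
    then show ?thesis by simp
  qed
  \<comment> \<open>The powers x^(1-q) and x^q combine to x, which forces the limit 0.\<close>
  have "((\<lambda>x. poly (pderiv p) (x powr (q + 1)) * ((q + 1) * x)) \<longlongrightarrow> poly (pderiv p) 0 * ((q + 1) * 0)) (at_right (0::real))"
    by (intro tendsto_intros X0)
  moreover have "\<forall>\<^sub>F x in at_right 0. poly (pderiv p) (x powr (q + 1)) * ((q + 1) * x) = x powr (1 - q) * u' x"
      using eventually_at_right_less[of 0]
      by eventually_elim (simp add: u'_def powr_diff)
  ultimately have lim: "((\<lambda>x. x powr (1 - q) * u' x) \<longlongrightarrow> 0) (at_right 0)"
    by (auto dest: Lim_transform_eventually)
  have "((\<lambda>x. poly p (x powr (q + 1))) \<longlongrightarrow> poly p 0) (at_right 0)"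
    by (intro tendsto_intros X0)
  \<comment> \<open>The constant coefficient is k^n, so u_n is nonzero near 0.\<close>
  moreover have "poly p 0 \<noteq> 0"
    using k by (simp add: p_def poly_0_coeff_0 coeff_monomial_poly monomial_coeff_def)
  ultimately have "\<forall>\<^sub>F x in at_right 0. poly p (x powr (q + 1)) \<noteq> 0"
    by (rule tendsto_imp_eventually_ne)
  then have "\<forall>\<^sub>F x in at_right (0::real). x > 0 \<and> poly p (x powr (q + 1)) \<noteq> 0"
    using eventually_at_right_less[of 0] by eventually_elim simp
  then obtain x where "x > 0" "poly p (x powr (q + 1)) \<noteq> 0"
    using eventually_happens'[OF trivial_limit_at_right_real] by blast
  then have nz: "\<exists>x>0. monomial A k q n x \<noteq> 0" using u by force
  show ?thesis
    unfolding eigenfunction_def using d1 d2 ode lim nz by blast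
qed

section \<open>Moments of the weight\<close>

text \<open>Substitute z = c x^(q+1) in Euler's integral for Gamma(k + 1/(q+1)).\<close>

lemma stretched_exponential_moment:
  fixes c q :: real
  assumes c: "c > 0" and q: "q > -1"
  shows "set_integrable lborel {0..} (\<lambda>x. (x powr (q + 1)) ^ k * exp (- (c * x powr (q + 1))))"
      (is "set_integrable _ _ ?h")
    and "(LINT x:{0..}|lborel. (x powr (q + 1)) ^ k * exp (- (c * x powr (q + 1)))) =
           1 / (q + 1) * c powr (- (1 / (q + 1))) * Gamma (real k + 1 / (q + 1)) / c ^ k"
proof -
  define s where "s = 1 / (q + 1)"
  define t where "t = real k + s"
  \<comment> \<open>The constant for which the substituted integrand is C times
    \<open>?h\<close>.\<close>
  define C where "C = c powr t * (q + 1)"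
  have s: "s > 0" using q by (simp add: s_def)
  then have t: "t > 0" by (simp add: t_def)
  have C: "C > 0" using c q by (simp add: C_def)
  define f where "f z = z powr (t - 1) / exp z" for z :: real
  define g where "g x = c * x powr (q + 1)" for x
  define g' where "g' x = c * ((q + 1) * x powr q)" for x
  have "(f has_integral Gamma t) {0..}"
    unfolding f_def by (rule Gamma_integral_real[OF t])
  \<comment> \<open>The null point 0 is removed, since the substitution need not be differentiable
    there; it is restored at the end.\<close>
  then have "(f has_integral Gamma t) {0<..}"
    by (subst has_integral_spike_set_eq[of _ "{0..}"]) (auto intro: negligible_subset[OF negligible_sing[of 0]])
  then have f: "f absolutely_integrable_on {0<..} \<and> integral {0<..} f = Gamma t"
    by (auto intro!: nonnegative_absolutely_integrable_1 simp: f_def has_integral_integrable integral_unique)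
  have im: "g ` {0<..} = {0<..}"
  proof safe
    fix y :: real assume "y > 0"
    then have "y = g ((y / c) powr s)" "(y / c) powr s \<in> {0<..}"
      using c q by (auto simp: g_def s_def powr_powr)
    then show "y \<in> g ` {0<..}" by blast
  qed (use c in \<open>auto simp: g_def\<close>)
  have "(\<lambda>x. \<bar>g' x\<bar> * f (g x)) absolutely_integrable_on {0<..} \<and>
        integral {0<..} (\<lambda>x. \<bar>g' x\<bar> * f (g x)) = Gamma t"
  proof (rule has_absolute_integral_change_of_variables_1'[of "{0<..}" g g' f "Gamma t", THEN iffD2])
    show "(g has_real_derivative g' x) (at x within {0<..})" if "x \<in> {0<..}" for x
      unfolding g_def g'_def using that has_real_derivative_powr[of x "q + 1"]
      by (intro DERIV_cmult) (auto intro: has_field_derivative_at_within)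
    show "inj_on g {0<..}"
      by (rule inj_on_inverseI[where g = "\<lambda>y. (y / c) powr s"])
         (use c q in \<open>auto simp: g_def s_def powr_powr\<close>)
  qed (use f in \<open>simp_all add: im\<close>)
  moreover have "\<bar>g' x\<bar> * f (g x) = C * ?h x" if "x \<in> {0<..}" for x
  proof -
    have x: "x > 0" using that by simp
    have "c powr t = c * c powr (t - 1)" using c by (simp add: powr_diff)
    moreover have "x powr q * (x powr (q + 1)) powr (t - 1) = (x powr (q + 1)) ^ k"
    proof -
      have "q + (q + 1) * (t - 1) = (q + 1) * real k"
        using q by (simp add: t_def s_def field_simps)
      then have "x powr q * (x powr (q + 1)) powr (t - 1) = x powr ((q + 1) * real k)"
        using x by (simp add: powr_powr flip: powr_add)
      then show ?thesis using x by (simp add: powr_realpow flip: powr_powr)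
    qed
    ultimately show ?thesis
      using c q by (simp add: g'_def f_def g_def C_def powr_mult exp_minus divide_inverse)
  qed
  note eq = this
  have "(\<lambda>x. \<bar>g' x\<bar> * f (g x)) absolutely_integrable_on {0<..} \<longleftrightarrow>
      (\<lambda>x. C * ?h x) absolutely_integrable_on {0<..}"
    by (rule set_integrable_cong) (rule refl eq | assumption)+
  moreover have "integral {0<..} (\<lambda>x. \<bar>g' x\<bar> * f (g x)) = integral {0<..} (\<lambda>x. C * ?h x)"
    by (rule integral_cong) (rule eq)
  ultimately have *: "(\<lambda>x. C * ?h x) absolutely_integrable_on {0<..}" "integral {0<..} (\<lambda>x. C * ?h x) = Gamma t"
    by simp_all
  \<comment> \<open>Absolute integrability refers to the completed measure; Borel measurability
    carries it back to \<open>lborel\<close>.\<close>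
  have meas: "(\<lambda>x. indicator {0<..} x *\<^sub>R (C * ?h x)) \<in> borel_measurable lborel" by measurable
  have "set_integrable lborel {0<..} (\<lambda>x. C * ?h x)"
    using *(1) meas by (simp add: set_integrable_def integrable_completion)
  moreover from this have "(LINT x:{0<..}|lborel. C * ?h x) = Gamma t"
    using set_borel_integral_eq_integral(2) *(2) by metis
  ultimately have I: "set_integrable lborel {0<..} ?h" "(LINT x:{0<..}|lborel. ?h x) = Gamma t / C"
    using C by (simp_all add: field_simps)
  show "set_integrable lborel {0..} ?h"
    using I(1) by (subst set_integrable_discrete_difference[where X = "{0}" and B = "{0<..}"]) auto
  have "(LINT x:{0..}|lborel. ?h x) = Gamma t / C"
    using I(2) by (subst set_integral_discrete_difference[where X = "{0}" and B = "{0<..}"]) auto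
  also have "\<dots> = 1 / (q + 1) * c powr (- s) * Gamma (real k + s) / c ^ k"
    using c by (simp add: C_def t_def powr_add powr_minus powr_realpow divide_simps)
  finally show "(LINT x:{0..}|lborel. ?h x) = 1 / (q + 1) * c powr (- (1 / (q + 1))) * Gamma (real k + 1 / (q + 1)) / c ^ k"
    unfolding s_def .
qed

section \<open>Complex powers and the constants\<close>

text \<open>The principal logarithm of a negative real a is ln |a| + i pi.\<close>

lemma cpow_eq:
  assumes "a \<noteq> 0"
  shows "cpow a r = of_real (\<bar>a\<bar> powr r) * (if a < 0 then cis (pi * r) else 1)"
proof (cases "a < 0")
  case True
  then have "Ln (of_real a) = of_real (ln \<bar>a\<bar>) + \<i> * of_real pi"
    by (simp add: Ln_of_real' mult.commute)
  then show ?thesis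
    using True by (simp add: cpow_def powr_def exp_add cis_conv_exp distrib_left mult_ac flip: exp_of_real)
next
  case False
  then show ?thesis using assms by (simp add: cpow_def powr_of_real)
qed

text \<open>
  When A < 0, the phase pi (2 - 2 s) + pi s on the right exceeds the phase pi (1 - s) on the left
  by pi; the resulting sign is that of A in passing from 1/A to 1/A^2.
\<close>
lemma normalization_constants:
  fixes A k q :: real
  assumes q: "q > -1" and Ak: "A / k < 0"
  shows "cpow (A / (q + 1)) (q / (q + 1)) * of_real (1 / A) *
      of_real (1 / (q + 1) * (- (A / (q + 1) / k)) powr (- (1 / (q + 1)))) =
     cpow (A / (q + 1)) (2 * q / (q + 1)) * of_real (1 / A\<^sup>2) * cpow (- k) (1 / (q + 1))"
proof -
  define s where "s = 1 / (q + 1)"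
  define b where "b = \<bar>A\<bar> / (q + 1)"
  have s: "q / (q + 1) = 1 - s" "2 * q / (q + 1) = 2 - 2 * s" "s > 0"
    using q by (simp_all add: s_def field_simps)
  have "A \<noteq> 0" using Ak by auto
  then have b: "b > 0" "\<bar>A\<bar> = b / s" using q by (simp_all add: b_def s_def)
  have k: "\<bar>k\<bar> > 0" using Ak by auto
  have c: "- (A / (q + 1) / k) = b / \<bar>k\<bar>"
    using Ak q by (auto simp: b_def divide_less_0_iff)
  \<comment> \<open>The identity of absolute values, multiplied by A^2; s |A| = b supplies the last
    factor.\<close>
  have R: "b powr (1 - s) * (s * (b / \<bar>k\<bar>) powr (- s)) * \<bar>A\<bar> = b powr (2 - 2 * s) * \<bar>k\<bar> powr s"
  proof -
    have "b powr (2 - 2 * s) = b powr (1 - s) * b powr (- s) * b"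
    proof -
      have "b powr (2 - 2 * s) = b powr ((1 - s) + (- s) + 1)" by simp
      then show ?thesis using b by (simp only: powr_add powr_one)
    qed
    then show ?thesis using b k \<open>s > 0\<close> by (simp add: powr_divide powr_minus divide_simps mult.commute[of s])
  qed
  have abs: "\<bar>A / (q + 1)\<bar> = b" using q by (simp add: b_def)
  show ?thesis
  proof (cases "A > 0")
    case True
    then have kneg: "k < 0" using Ak by (simp add: divide_less_0_iff)
    have "b powr (1 - s) * (1 / A) * (s * (b / \<bar>k\<bar>) powr (- s)) = b powr (2 - 2 * s) * (1 / A\<^sup>2) * \<bar>k\<bar> powr s"
      using R True by (simp add: field_simps power2_eq_square)
    note r = this
    have pos: "\<not> A / (q + 1) < 0" "A / (q + 1) \<noteq> 0" using True q by (auto simp: divide_less_0_iff)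
    have "cpow (A / (q + 1)) (1 - s) * of_real (1 / A) * of_real (s * (b / \<bar>k\<bar>) powr (- s))
      = of_real (b powr (1 - s) * (1 / A) * (s * (b / \<bar>k\<bar>) powr (- s)))"
      using pos(1) unfolding cpow_eq[OF pos(2)] abs by (simp only: if_False of_real_mult mult_1_right mult.assoc)
    also have "\<dots> = cpow (A / (q + 1)) (2 - 2 * s) * of_real (1 / A\<^sup>2) * cpow (- k) s"
      unfolding r cpow_eq[OF pos(2)] abs using pos(1) kneg by (simp add: cpow_eq)
    finally show ?thesis unfolding c s s_def[symmetric] .
  next
    case False
    then have A: "A < 0" using Ak by (cases "A = 0") auto
    then have kpos: "k > 0" using Ak by (simp add: divide_less_0_iff)
    have r: "b powr (1 - s) * (1 / A) * (s * (b / \<bar>k\<bar>) powr (- s)) = - (b powr (2 - 2 * s) * (1 / A\<^sup>2) * \<bar>k\<bar> powr s)"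
      using R A by (simp add: field_simps power2_eq_square)
    have neg: "A / (q + 1) < 0" "A / (q + 1) \<noteq> 0" using A q by (auto simp: divide_less_0_iff)
    have ph: "cis (pi * (2 - 2 * s)) * cis (pi * s) = - cis (pi * (1 - s))"
    proof -
      have "cis (pi * (2 - 2 * s)) * cis (pi * s) = cis (pi + pi * (1 - s))"
        by (simp add: cis_mult algebra_simps)
      then show ?thesis by (simp flip: cis_mult)
    qed
    have "cpow (A / (q + 1)) (1 - s) * of_real (1 / A) * of_real (s * (b / \<bar>k\<bar>) powr (- s))
      = cis (pi * (1 - s)) * of_real (b powr (1 - s) * (1 / A) * (s * (b / \<bar>k\<bar>) powr (- s)))"
      unfolding cpow_eq[OF neg(2)] abs using neg(1) by simp
    also have "\<dots> = of_real (b powr (2 - 2 * s) * (1 / A\<^sup>2) * \<bar>k\<bar> powr s) * (- cis (pi * (1 - s)))"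
      unfolding r by simp
    also have "\<dots> = cpow (A / (q + 1)) (2 - 2 * s) * of_real (1 / A\<^sup>2) * cpow (- k) s"
      unfolding ph[symmetric] cpow_eq[OF neg(2)] abs using neg(1) kpos by (simp add: cpow_eq)
    finally show ?thesis unfolding c s s_def[symmetric] .
  qed
qed

section \<open>Orthogonality and normalization\<close>

text \<open>Both polynomials are expanded and the one of index n is summed first. Because m \<le> n,
  every power i of the other is at most n, so only i = n = m survives.\<close>

lemma has_bochner_integral_monomial_poly_product:
  fixes b c k q :: real
  assumes c: "c > 0" and q: "q > -1" and b: "b = - (c * k)" and mn: "m \<le> n"
  defines "s \<equiv> 1 / (q + 1)"
  shows "has_bochner_integral lborel
     (\<lambda>x. indicator {0..} x *\<^sub>R (exp (- (c * x powr (q + 1))) *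
        (poly (monomial_poly b k s n) (x powr (q + 1)) * poly (monomial_poly b k s m) (x powr (q + 1)))))
     (s * c powr (- s) * (Gamma s * (if n = m then k ^ (2 * n) * fact n / pochhammer s n else 0)))"
proof -
  let ?X = "\<lambda>x::real. x powr (q + 1)"
  let ?w = "\<lambda>i x. indicator {0..} x *\<^sub>R (?X x ^ i * exp (- (c * ?X x)))"
  have s: "s > 0" using q by (simp add: s_def)
  define K where "K = s * c powr (- s) * Gamma s"
  have moment: "has_bochner_integral lborel (?w i) (K * (pochhammer s i / c ^ i))" for i
    using stretched_exponential_moment[OF c q, of i] Gamma_add_of_nat_pochhammer[OF s, of i]
    unfolding has_bochner_integral_iff set_integrable_def set_lebesgue_integral_def K_def s_def
    by simp
  have "has_bochner_integral lborel
     (\<lambda>x. \<Sum>i\<le>m. \<Sum>j\<le>n. monomial_coeff b k s m i * monomial_coeff b k s n j * ?w (i + j) x)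
     (\<Sum>i\<le>m. \<Sum>j\<le>n. monomial_coeff b k s m i * monomial_coeff b k s n j * (K * (pochhammer s (i + j) / c ^ (i + j))))"
    by (intro has_bochner_integral_sum has_bochner_integral_mult_right moment)
  moreover have "(\<lambda>x. \<Sum>i\<le>m. \<Sum>j\<le>n. monomial_coeff b k s m i * monomial_coeff b k s n j * ?w (i + j) x) =
     (\<lambda>x. indicator {0..} x *\<^sub>R (exp (- (c * ?X x)) * (poly (monomial_poly b k s n) (?X x) * poly (monomial_poly b k s m) (?X x))))"
  proof
    fix x
    have "poly (monomial_poly b k s n) (?X x) * poly (monomial_poly b k s m) (?X x)
       = (\<Sum>i\<le>m. \<Sum>j\<le>n. (monomial_coeff b k s m i * ?X x ^ i) * (monomial_coeff b k s n j * ?X x ^ j))"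
      unfolding poly_monomial_poly by (subst mult.commute) (rule sum_product)
    then show "(\<Sum>i\<le>m. \<Sum>j\<le>n. monomial_coeff b k s m i * monomial_coeff b k s n j * ?w (i + j) x) =
      indicator {0..} x *\<^sub>R (exp (- (c * ?X x)) * (poly (monomial_poly b k s n) (?X x) * poly (monomial_poly b k s m) (?X x)))"
      by (simp add: sum_distrib_left power_add mult_ac)
  qed
  moreover have "(\<Sum>i\<le>m. \<Sum>j\<le>n. monomial_coeff b k s m i * monomial_coeff b k s n j * (K * (pochhammer s (i + j) / c ^ (i + j))))
      = s * c powr (- s) * (Gamma s * (if n = m then k ^ (2 * n) * fact n / pochhammer s n else 0))"
  proof -
    \<comment> \<open>With b = -c k the powers reduce to (-1)^j k^n / c^i, and (s)_(i+j) = (s)_j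
      (s+j)_i cancels the denominator (s)_j; the finite difference formula applies.\<close>
    have inner: "(\<Sum>j\<le>n. monomial_coeff b k s n j * (pochhammer s (i + j) / c ^ (i + j))) =
        (if i = n then k ^ n * (-1) ^ n * fact n / c ^ n else 0)" if "i \<le> n" for i
    proof -
      have "(\<Sum>j\<le>n. monomial_coeff b k s n j * (pochhammer s (i + j) / c ^ (i + j))) =
        (\<Sum>j\<le>n. k ^ n / c ^ i * ((-1) ^ j * real (n choose j) * pochhammer (s + real j) i))"
      proof (rule sum.cong)
        fix j assume "j \<in> {..n}"
        then have K: "k ^ n = k ^ (n - j) * k ^ j" by (simp flip: power_add)
        have B: "b ^ j = (-1) ^ j * c ^ j * k ^ j"
          unfolding b using power_minus[of "c * k" j] by (simp add: power_mult_distrib)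
        have P: "pochhammer s (i + j) = pochhammer s j * pochhammer (s + real j) i"
          using pochhammer_product'[of s j i] by (simp add: add.commute)
        have "pochhammer s j > 0" using s by (rule pochhammer_pos)
        then show "monomial_coeff b k s n j * (pochhammer s (i + j) / c ^ (i + j)) =
            k ^ n / c ^ i * ((-1) ^ j * real (n choose j) * pochhammer (s + real j) i)"
          unfolding monomial_coeff_def K B P using c by (simp add: power_add)
      qed simp
      also have "\<dots> = k ^ n / c ^ i * (if i = n then (-1) ^ n * fact n else 0)"
        unfolding sum_distrib_left[symmetric] alternating_sum_pochhammer[OF that] ..
      finally show ?thesis by simp
    qed
    have "(\<Sum>i\<le>m. \<Sum>j\<le>n. monomial_coeff b k s m i * monomial_coeff b k s n j * (K * (pochhammer s (i + j) / c ^ (i + j))))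
      = (\<Sum>i\<le>m. K * monomial_coeff b k s m i * (\<Sum>j\<le>n. monomial_coeff b k s n j * (pochhammer s (i + j) / c ^ (i + j))))"
      by (simp add: sum_distrib_left mult_ac)
    also have "\<dots> = (\<Sum>i\<le>m. K * monomial_coeff b k s m i * (if i = n then k ^ n * (-1) ^ n * fact n / c ^ n else 0))"
      by (rule sum.cong[OF refl]) (use mn in \<open>simp only: inner atMost_iff order.trans\<close>)
    also have "\<dots> = (if n = m then K * monomial_coeff b k s n n * (k ^ n * (-1) ^ n * fact n / c ^ n) else 0)"
      using mn by (auto simp: if_distrib cong: if_cong)
    also have "\<dots> = K * (if n = m then k ^ (2 * n) * fact n / pochhammer s n else 0)"
    proof -
      \<comment> \<open>The leading coefficient b^n/(s)_n cancels the sign and c^n of the inner sum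
        and contributes a second k^n.\<close>
      have B: "b ^ n = (-1) ^ n * c ^ n * k ^ n"
        unfolding b using power_minus[of "c * k" n] by (simp add: power_mult_distrib)
      have "monomial_coeff b k s n n * (k ^ n * (-1) ^ n * fact n / c ^ n) = k ^ (2 * n) * fact n / pochhammer s n"
        unfolding monomial_coeff_def B using c by (simp add: mult_2_right power_add mult_ac)
      then show ?thesis by (simp only: mult.assoc if_distrib[of "(*) K"] mult_zero_right)
    qed
    finally show ?thesis by (simp add: K_def mult.assoc)
  qed
  ultimately show ?thesis by simp
qed

lemma has_bochner_integral_norm_integrand:
  assumes q: "q > -1" and Ak: "A / k < 0" and mn: "m \<le> n"
  shows "has_bochner_integral lborel (\<lambda>x. indicator {0..} x *\<^sub>R norm_integrand A k q n m x)
     (of_real ((Gamma (1 / (1 + q)))\<^sup>2 * fact n / Gamma (real n + 1 / (1 + q)))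
          * cpow (A / (q + 1)) (2 * q / (q + 1)) * of_real (1 / A\<^sup>2)
          * cpow (- k) (1 / (q + 1))
          * of_real (k ^ (2 * n))
          * (if n = m then 1 else 0))"
proof -
  define s b c where "s = 1 / (q + 1)" and "b = A / (q + 1)" and "c = - (b / k)"
  define C where "C = cpow b (q / (q + 1)) * of_real (1 / A)"
  define v where "v = Gamma s * (if n = m then k ^ (2 * n) * fact n / pochhammer s n else 0)"
  let ?X = "\<lambda>x::real. x powr (q + 1)"
  have k: "k \<noteq> 0" using Ak by auto
  have s: "s > 0" using q by (simp add: s_def)
  have "c = - (A / k) / (q + 1)" by (simp add: c_def b_def)
  then have c: "c > 0" using Ak q by (simp only: divide_pos_pos neg_0_less_iff_less add_pos_pos less_diff_eq[symmetric] diff_0)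
  have bc: "b = - (c * k)" using k by (simp add: c_def)
  have "has_bochner_integral lborel
     (\<lambda>x. C * of_real (indicator {0..} x *\<^sub>R (exp (- (c * ?X x)) * (poly (monomial_poly b k s n) (?X x) * poly (monomial_poly b k s m) (?X x)))))
     (C * of_real (s * c powr (- s) * v))"
    unfolding s_def v_def
    by (intro has_bochner_integral_mult_right has_bochner_integral_of_real
        has_bochner_integral_monomial_poly_product[OF c q bc mn])
  also have "(\<lambda>x. C * of_real (indicator {0..} x *\<^sub>R (exp (- (c * ?X x)) * (poly (monomial_poly b k s n) (?X x) * poly (monomial_poly b k s m) (?X x)))))
     = (\<lambda>x. indicator {0..} x *\<^sub>R norm_integrand A k q n m x)"
  proof
    fix x
    have "A * ?X x / (k * (q + 1)) = - (c * ?X x)" by (simp add: c_def b_def)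
    then show "C * of_real (indicator {0..} x *\<^sub>R (exp (- (c * ?X x)) * (poly (monomial_poly b k s n) (?X x) * poly (monomial_poly b k s m) (?X x))))
       = indicator {0..} x *\<^sub>R norm_integrand A k q n m x"
      \<comment> \<open>The polynomial form of u_n is available for x \<ge> 0 only; elsewhere the
        indicator is 0.\<close>
      by (cases "x \<ge> 0") (simp_all add: norm_integrand_def monomial_eq_monomial_poly[OF q] C_def b_def s_def)
  qed
  also have "C * of_real (s * c powr (- s) * v) =
      (C * of_real (s * c powr (- s))) * of_real v" by simp
  also have "C * of_real (s * c powr (- s)) =
      cpow b (2 * q / (q + 1)) * of_real (1 / A\<^sup>2) * cpow (- k) s"
    using normalization_constants[OF q Ak] unfolding C_def b_def c_def s_def .
  also have "v = (Gamma s)\<^sup>2 * fact n / Gamma (real n + s) * (if n = m then k ^ (2 * n) else 0)"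
    unfolding v_def Gamma_add_of_nat_pochhammer[OF s] using Gamma_real_pos[OF s]
    by (simp add: power2_eq_square)
  finally show ?thesis
    by (simp add: s_def b_def add.commute[of 1 q] mult_ac split: if_splits)
qed

text \<open>The sign condition on A / k0 makes the weight decay. The factor
  \<open>k0 ^ (2 * n)\<close> in the norm reflects the factor k0^n in the Laguerre form of u_n,
  which enters twice.\<close>

theorem theorem5:
  fixes A k0 q :: real and n m :: nat
  assumes "k0 \<noteq> 0" and "q > -1"
  shows "eigenfunction A k0 q n (monomial A k0 q n) \<and>
    (\<forall>x\<ge>0. monomial A k0 q n x =
        Gamma (1 / (1 + q)) * fact n / Gamma (real n + 1 / (1 + q)) * k0 ^ n *
        gen_laguerre n (- q / (q + 1)) (- A / (k0 * (q + 1)) * x powr (q + 1))) \<and>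
    (A / k0 < 0 \<longrightarrow>
        set_integrable lborel {0..} (norm_integrand A k0 q n m) \<and>
        (LINT x:{0..}|lborel. norm_integrand A k0 q n m x) =
          of_real ((Gamma (1 / (1 + q)))\<^sup>2 * fact n / Gamma (real n + 1 / (1 + q)))
          * cpow (A / (q + 1)) (2 * q / (q + 1)) * of_real (1 / A\<^sup>2)
          * cpow (- k0) (1 / (q + 1))
          * of_real (k0 ^ (2 * n))
          * (if n = m then 1 else 0))"
proof (intro conjI allI impI)
  show "eigenfunction A k0 q n (monomial A k0 q n)"
    using assms by (rule eigenfunction_monomial)
next
  fix x :: real assume x: "x \<ge> 0"
  have "1 / (q + 1) - 1 = - q / (q + 1)" using assms(2) by (simp add: field_simps)
  then show "monomial A k0 q n x =
        Gamma (1 / (1 + q)) * fact n / Gamma (real n + 1 / (1 + q)) * k0 ^ n *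
        gen_laguerre n (- q / (q + 1)) (- A / (k0 * (q + 1)) * x powr (q + 1))"
    unfolding monomial_eq_monomial_poly[OF assms(2) x]
    using monomial_poly_eq_gen_laguerre[of "1 / (q + 1)" k0 "A / (q + 1)" n "x powr (q + 1)"] assms
    by (simp add: add.commute[of 1 q] mult.commute[of k0])
next
  \<comment> \<open>By symmetry one may take the smaller index second; for n \<noteq> m the value is
    0 in either order.\<close>
  have "norm_integrand A k0 q n m = norm_integrand A k0 q m n"
    by (simp add: fun_eq_iff norm_integrand_def)
  moreover assume "A / k0 < 0"
  ultimately have "has_bochner_integral lborel (\<lambda>x. indicator {0..} x *\<^sub>R norm_integrand A k0 q n m x)
     (of_real ((Gamma (1 / (1 + q)))\<^sup>2 * fact n / Gamma (real n + 1 / (1 + q)))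
          * cpow (A / (q + 1)) (2 * q / (q + 1)) * of_real (1 / A\<^sup>2)
          * cpow (- k0) (1 / (q + 1))
          * of_real (k0 ^ (2 * n))
          * (if n = m then 1 else 0))"
    using has_bochner_integral_norm_integrand[of q A k0 m n]
      has_bochner_integral_norm_integrand[of q A k0 n m] assms(2)
    by (cases "m \<le> n") simp_all
  then show "set_integrable lborel {0..} (norm_integrand A k0 q n m)"
    and "(LINT x:{0..}|lborel. norm_integrand A k0 q n m x) =
          of_real ((Gamma (1 / (1 + q)))\<^sup>2 * fact n / Gamma (real n + 1 / (1 + q)))
          * cpow (A / (q + 1)) (2 * q / (q + 1)) * of_real (1 / A\<^sup>2)
          * cpow (- k0) (1 / (q + 1))
          * of_real (k0 ^ (2 * n))
          * (if n = m then 1 else 0)"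
    by (simp_all only: has_bochner_integral_iff set_integrable_def set_lebesgue_integral_def)
qed

end
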